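(* Assume the bipartite graph $\mathcal{T}$ is a tree of diameter $3$. Consider the system, for measurable locally bounded functions $w_i,y_i$ ($i\in\mathcal{I}$), $z_j$ ($j\in\mathcal{J}$), $\psi_{ij}$ (with $\psi_{ij}=0$ for $i\not\sim j$) on an interval: $$\text{(S1)}\ \sum_{j\in\mathcal{J}}(\psi_{ij}+\mu_{ij}\mathfrak{J}\psi_{ij})=w_i-y_i-\theta_i\mathfrak{J}y_i,\ i\in\mathcal{I};\quad \text{(S2)}\ \sum_{i\in\mathcal{I}}\psi_{ij}=-z_j,\ j\in\mathcal{J};$$ $$\text{(S3)}\ y_i\ge0,\ z_j\ge0;\quad \text{(S4)}\ \min(e\cdot y,e\cdot z)=0.$$ Suppose this system has the nonidling property: for every $T>0$, whenever (S1)–(S4) hold on $[0,T)$, $w_i(0)>0$ and each $w_i$ is strictly increasing and right-continuous on $[0,T)$, then $z_j(t)=0$ for all $t\in[0,T)$, $j\in\mathcal{J}$. Then there is a constant $m_4$ such that for every $(\psi,y,z,w)$ satisfying (S1)–(S4) on $[0,\infty)$, with $x_i:=w_i-\sum_{j}\mu_{ij}\mathfrak{J}\psi_{ij}-\theta_i\mathfrak{J}y_i$, $$\|x(t)\|\le m_4(1+t)^{m_4}(1+\|w\|_t^* ),\qquad t\ge0;$$ $m_4$ does not depend on $t,w,y,z,\psi$.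
   Context: $\mathcal{I}=\{1,\dots,I\}$, $\mathcal{J}=\{I+1,\dots,I+J\}$, $\mathcal{E}\subset\mathcal{I}\times\mathcal{J}$, $i\sim j$ iff $(i,j)\in\mathcal{E}$; $\mathcal{T}$ is the bipartite graph with vertices $\mathcal{I}\cup\mathcal{J}$ and edges $\mathcal{E}$. Constants $\mu_{ij}>0$ for $(i,j)\in\mathcal{E}$, $\mu_{ij}=0$ otherwise, $\theta_i\ge0$. $\mathfrak{J}f(t)=\int_0^tf(s)ds$. $\|x\|=\sum|x_i|$, $\|w\|_t^*=\sup_{0\le s\le t}\|w(s)\|$, $e=(1,\dots,1)'$. *)

theory Defs
  imports "HOL-Analysis.Analysis"
begin

definition Iset :: "nat \<Rightarrow> nat set" where
  "Iset nI = {1..nI}"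

definition Jset :: "nat \<Rightarrow> nat \<Rightarrow> nat set" where
  "Jset nI nJ = {nI+1..nI+nJ}"

definition gadj :: "(nat \<times> nat) set \<Rightarrow> nat \<Rightarrow> nat \<Rightarrow> bool" where
  "gadj E u v \<longleftrightarrow> (u, v) \<in> E \<or> (v, u) \<in> E"

definition is_walk :: "nat set \<Rightarrow> (nat \<Rightarrow> nat \<Rightarrow> bool) \<Rightarrow> nat list \<Rightarrow> bool" where
  "is_walk V adj vs \<longleftrightarrow> vs \<noteq> [] \<and> set vs \<subseteq> V \<and>
     (\<forall>k. Suc k < length vs \<longrightarrow> adj (vs ! k) (vs ! Suc k))"

definition graph_connected :: "nat set \<Rightarrow> (nat \<Rightarrow> nat \<Rightarrow> bool) \<Rightarrow> bool" where
  "graph_connected V adj \<longleftrightarrow>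
     (\<forall>u\<in>V. \<forall>v\<in>V. \<exists>vs. is_walk V adj vs \<and> hd vs = u \<and> last vs = v)"

definition is_cycle :: "nat set \<Rightarrow> (nat \<Rightarrow> nat \<Rightarrow> bool) \<Rightarrow> nat list \<Rightarrow> bool" where
  "is_cycle V adj vs \<longleftrightarrow> length vs \<ge> 3 \<and> distinct vs \<and> is_walk V adj vs \<and> adj (last vs) (hd vs)"

definition is_tree :: "nat set \<Rightarrow> (nat \<Rightarrow> nat \<Rightarrow> bool) \<Rightarrow> bool" where
  "is_tree V adj \<longleftrightarrow> V \<noteq> {} \<and> graph_connected V adj \<and> \<not> (\<exists>vs. is_cycle V adj vs)"

definition graph_dist :: "nat set \<Rightarrow> (nat \<Rightarrow> nat \<Rightarrow> bool) \<Rightarrow> nat \<Rightarrow> nat \<Rightarrow> nat" where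
  "graph_dist V adj u v =
     (LEAST n. \<exists>vs. is_walk V adj vs \<and> hd vs = u \<and> last vs = v \<and> length vs = Suc n)"

definition graph_diameter :: "nat set \<Rightarrow> (nat \<Rightarrow> nat \<Rightarrow> bool) \<Rightarrow> nat" where
  "graph_diameter V adj = Max {graph_dist V adj u v | u v. u \<in> V \<and> v \<in> V}"

definition tree_diam3 :: "nat \<Rightarrow> nat \<Rightarrow> (nat \<times> nat) set \<Rightarrow> bool" where
  "tree_diam3 nI nJ E \<longleftrightarrow>
     is_tree (Iset nI \<union> Jset nI nJ) (gadj E) \<and>
     graph_diameter (Iset nI \<union> Jset nI nJ) (gadj E) = 3"

definition Jint :: "(real \<Rightarrow> real) \<Rightarrow> real \<Rightarrow> real" where
  "Jint f t = (LINT s:{0..t}|lborel. f s)"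

text \<open>Measurable and locally bounded on the interval S (S = [0,T) or [0,\<infinity>)).\<close>
definition meas_locbdd :: "real set \<Rightarrow> (real \<Rightarrow> real) \<Rightarrow> bool" where
  "meas_locbdd S f \<longleftrightarrow> set_borel_measurable lborel S f \<and>
     (\<forall>t\<in>S. \<exists>B. \<forall>s\<in>{0..t}. \<bar>f s\<bar> \<le> B)"

definition system_on ::
  "nat \<Rightarrow> nat \<Rightarrow> (nat \<times> nat) set \<Rightarrow> (nat \<Rightarrow> nat \<Rightarrow> real) \<Rightarrow> (nat \<Rightarrow> real) \<Rightarrow> real set \<Rightarrow>
   (nat \<Rightarrow> nat \<Rightarrow> real \<Rightarrow> real) \<Rightarrow> (nat \<Rightarrow> real \<Rightarrow> real) \<Rightarrow> (nat \<Rightarrow> real \<Rightarrow> real) \<Rightarrow>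
   (nat \<Rightarrow> real \<Rightarrow> real) \<Rightarrow> bool" where
  "system_on nI nJ E \<mu> \<theta> S \<psi> y z w \<longleftrightarrow>
     (\<forall>i\<in>Iset nI. meas_locbdd S (w i) \<and> meas_locbdd S (y i)) \<and>
     (\<forall>j\<in>Jset nI nJ. meas_locbdd S (z j)) \<and>
     (\<forall>i\<in>Iset nI. \<forall>j\<in>Jset nI nJ. meas_locbdd S (\<psi> i j)) \<and>
     (\<forall>i\<in>Iset nI. \<forall>j\<in>Jset nI nJ. (i, j) \<notin> E \<longrightarrow> (\<forall>t\<in>S. \<psi> i j t = 0)) \<and>
     (\<forall>t\<in>S.
        (\<forall>i\<in>Iset nI. (\<Sum>j\<in>Jset nI nJ. \<psi> i j t + \<mu> i j * Jint (\<psi> i j) t)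
                        = w i t - y i t - \<theta> i * Jint (y i) t) \<and>
        (\<forall>j\<in>Jset nI nJ. (\<Sum>i\<in>Iset nI. \<psi> i j t) = - z j t) \<and>
        (\<forall>i\<in>Iset nI. y i t \<ge> 0) \<and> (\<forall>j\<in>Jset nI nJ. z j t \<ge> 0) \<and>
        min (\<Sum>i\<in>Iset nI. y i t) (\<Sum>j\<in>Jset nI nJ. z j t) = 0)"

definition nonidling ::
  "nat \<Rightarrow> nat \<Rightarrow> (nat \<times> nat) set \<Rightarrow> (nat \<Rightarrow> nat \<Rightarrow> real) \<Rightarrow> (nat \<Rightarrow> real) \<Rightarrow> bool" where
  "nonidling nI nJ E \<mu> \<theta> \<longleftrightarrow>
     (\<forall>T>0. \<forall>\<psi> y z w.
        system_on nI nJ E \<mu> \<theta> {0..<T} \<psi> y z w \<and>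
        (\<forall>i\<in>Iset nI. w i 0 > 0) \<and>
        (\<forall>i\<in>Iset nI. strict_mono_on {0..<T} (w i)) \<and>
        (\<forall>i\<in>Iset nI. \<forall>t\<in>{0..<T}. continuous (at_right t) (w i))
        \<longrightarrow> (\<forall>t\<in>{0..<T}. \<forall>j\<in>Jset nI nJ. z j t = 0))"

definition xproc ::
  "nat \<Rightarrow> nat \<Rightarrow> (nat \<Rightarrow> nat \<Rightarrow> real) \<Rightarrow> (nat \<Rightarrow> real) \<Rightarrow>
   (nat \<Rightarrow> nat \<Rightarrow> real \<Rightarrow> real) \<Rightarrow> (nat \<Rightarrow> real \<Rightarrow> real) \<Rightarrow> (nat \<Rightarrow> real \<Rightarrow> real) \<Rightarrow>
   nat \<Rightarrow> real \<Rightarrow> real" where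
  "xproc nI nJ \<mu> \<theta> \<psi> y w i t =
     w i t - (\<Sum>j\<in>Jset nI nJ. \<mu> i j * Jint (\<psi> i j) t) - \<theta> i * Jint (y i) t"

definition l1norm :: "nat set \<Rightarrow> (nat \<Rightarrow> real) \<Rightarrow> real" where
  "l1norm A v = (\<Sum>i\<in>A. \<bar>v i\<bar>)"

definition supnorm :: "nat set \<Rightarrow> (nat \<Rightarrow> real \<Rightarrow> real) \<Rightarrow> real \<Rightarrow> real" where
  "supnorm A w t = (SUP s\<in>{0..t}. l1norm A (\<lambda>i. w i s))"

end

theory Submission
  imports Defs
begin

text \<open>
  A bipartite tree of diameter 3 is a double star: every class is served by a centre \<open>j0\<close>, every pool
  serves a centre \<open>i0\<close>, and there are no other edges. Put \<open>m i = \<mu> i j0\<close>, \<open>a = max m\<close> and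
  \<open>X = \<Sum>i. x i\<close>; then (S1)--(S4) amount to \<open>\<Sum>y = max X 0\<close>, \<open>\<Sum>z = max (-X) 0\<close> and
  \<open>x i = w i + \<integral> (- m i * x i + (m i - \<theta> i) * y i + [i = i0] * (\<Sum>j. (\<mu> i0 j - m i0) * z j))\<close>.

  Nonidling forces \<open>\<theta> k \<le> m k\<close> whenever \<open>m k < a\<close>: otherwise an explicit trajectory that puts the whole queue
  into class \<open>k\<close> makes \<open>X\<close> negative although every \<open>w i\<close> increases.
  Given this, \<open>x i\<close> is bounded below by a multiple of \<open>N = sup \<bar>w\<bar>\<close> for each slow class (\<open>m i < a\<close>), and so is
  \<open>X\<close>; the two bounds depend on each other through \<open>z\<close>, but the loop contracts by the factor
  \<open>1 - min (\<mu> i0 j) / m i0 < 1\<close>. The workload \<open>\<Sum>i. x i / m i\<close> increases only through \<open>z\<close>, hence at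
  most linearly, and \<open>X = a * (\<Sum>i. x i / m i - \<Sum>i. x i * (1 / m i - 1 / a))\<close>, where the last sum
  involves slow classes only, bounds \<open>X\<close> from above. Finally \<open>X\<close> controls \<open>y\<close> and \<open>z\<close>, which control each \<open>x i\<close>.
\<close>

section \<open>Trees of diameter three\<close>

lemma graph_dist_witness:
  assumes "graph_connected V adj" "u \<in> V" "v \<in> V"
  obtains vs where "is_walk V adj vs" "hd vs = u" "last vs = v" "length vs = Suc (graph_dist V adj u v)"
proof -
  from assms obtain vs where vs: "is_walk V adj vs" "hd vs = u" "last vs = v"
    unfolding graph_connected_def by blast
  then have "length vs = Suc (length vs - 1)" by (auto simp: is_walk_def)
  with vs have "\<exists>n vs. is_walk V adj vs \<and> hd vs = u \<and> last vs = v \<and> length vs = Suc n" by blast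
  from LeastI_ex[OF this] show ?thesis using that unfolding graph_dist_def by blast
qed

lemma graph_dist_le:
  assumes "is_walk V adj vs" "hd vs = u" "last vs = v" "length vs = Suc n"
  shows "graph_dist V adj u v \<le> n"
  unfolding graph_dist_def by (rule Least_le) (use assms in blast)

lemma is_walk_Cons_Cons:
  "is_walk V adj (a # b # vs) \<longleftrightarrow> a \<in> V \<and> adj a b \<and> is_walk V adj (b # vs)"
  by (auto simp: is_walk_def nth_Cons split: nat.splits)

lemma is_walk_single: "is_walk V adj [a] \<longleftrightarrow> a \<in> V"
  by (auto simp: is_walk_def)

lemmas is_walk_simps = is_walk_Cons_Cons is_walk_single

text \<open>A path realising the diameter has leaves \<open>i1\<close> and \<open>j1\<close> as its
  ends. Any other class must share a neighbour with \<open>i1\<close>, and any other pool with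
  \<open>j1\<close>, so the inner vertices \<open>j0\<close> and \<open>i0\<close> are
  centres.\<close>

lemma tree_diam3_double_star:
  assumes E: "E \<subseteq> Iset nI \<times> Jset nI nJ" and tree: "tree_diam3 nI nJ E"
  shows "\<exists>i0\<in>Iset nI. \<exists>j0\<in>Jset nI nJ. (\<forall>i\<in>Iset nI. (i, j0) \<in> E) \<and> (\<forall>j\<in>Jset nI nJ. (i0, j) \<in> E)
    \<and> (\<forall>i j. (i, j) \<in> E \<longrightarrow> i = i0 \<or> j = j0)"
proof -
  define I where "I = Iset nI"
  define J where "J = Jset nI nJ"
  define V where "V = I \<union> J"
  have fin: "finite V" by (simp add: V_def I_def J_def Iset_def Jset_def)
  have disj: "x \<in> I \<Longrightarrow> x \<in> J \<Longrightarrow> False" for x by (auto simp: I_def J_def Iset_def Jset_def)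
  have EIJ: "(i, j) \<in> E \<Longrightarrow> i \<in> I \<and> j \<in> J" for i j using E by (auto simp: I_def J_def)
  let ?adj = "gadj E"
  have conn: "graph_connected V ?adj" and ne: "V \<noteq> {}" and acyc: "\<not> is_cycle V ?adj vs"
    and diam: "graph_diameter V ?adj = 3" for vs
    using tree by (auto simp: tree_diam3_def is_tree_def V_def I_def J_def)
  define D where "D = {graph_dist V ?adj u v | u v. u \<in> V \<and> v \<in> V}"
  have "D = (\<lambda>(u, v). graph_dist V ?adj u v) ` (V \<times> V)" by (auto simp: D_def)
  then have finD: "finite D" and neD: "D \<noteq> {}" using fin ne by auto
  have maxD: "Max D = 3" using diam by (simp add: graph_diameter_def D_def)
  have short: "\<exists>vs. is_walk V ?adj vs \<and> hd vs = u \<and> last vs = v \<and> length vs \<in> {1, 2, 3, 4}"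
    if "u \<in> V" "v \<in> V" for u v
  proof -
    have "graph_dist V ?adj u v \<le> 3" using Max_ge[OF finD, of "graph_dist V ?adj u v"] that maxD
      by (auto simp: D_def)
    moreover obtain vs where "is_walk V ?adj vs" "hd vs = u" "last vs = v"
      "length vs = Suc (graph_dist V ?adj u v)" using graph_dist_witness[OF conn \<open>u \<in> V\<close> \<open>v \<in> V\<close>] by blast
    ultimately show ?thesis by (intro exI[of _ vs]) auto
  qed
  have len_cases: "(\<exists>a. vs = [a]) \<or> (\<exists>a b. vs = [a, b]) \<or> (\<exists>a b c. vs = [a, b, c])
      \<or> (\<exists>a b c d. vs = [a, b, c, d])" if "length vs \<in> {1, 2, 3, 4}" for vs :: "nat list"
    using that by (auto simp: length_Suc_conv numeral_eq_Suc)
  \<comment> \<open>By bipartiteness a walk between vertices of one side has an even number of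
    edges; with at most three edges and distinct ends, its midpoint is a common neighbour.\<close>
  have two_I: "\<exists>j. (u, j) \<in> E \<and> (v, j) \<in> E" if uv: "u \<in> I" "v \<in> I" "u \<noteq> v" for u v
  proof -
    obtain vs where vs: "is_walk V ?adj vs" "hd vs = u" "last vs = v" "length vs \<in> {1, 2, 3, 4}"
      using short[of u v] uv unfolding V_def by blast
    show ?thesis using len_cases[OF vs(4)] vs(1-3) uv EIJ disj
      by (elim disjE exE) (auto simp: is_walk_simps gadj_def, blast+)
  qed
  have two_J: "\<exists>i. (i, u) \<in> E \<and> (i, v) \<in> E" if uv: "u \<in> J" "v \<in> J" "u \<noteq> v" for u v
  proof -
    obtain vs where vs: "is_walk V ?adj vs" "hd vs = u" "last vs = v" "length vs \<in> {1, 2, 3, 4}"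
      using short[of u v] uv unfolding V_def by blast
    show ?thesis using len_cases[OF vs(4)] vs(1-3) uv EIJ disj
      by (elim disjE exE) (auto simp: is_walk_simps gadj_def, blast+)
  qed
  have no4: False if "(a, b) \<in> E" "(c, b) \<in> E" "(c, d) \<in> E" "(a, d) \<in> E" "a \<noteq> c" "b \<noteq> d" for a b c d
  proof -
    have "is_cycle V ?adj [a, b, c, d]"
      using that EIJ disj by (auto simp: is_cycle_def is_walk_simps gadj_def V_def)
    then show False using acyc by blast
  qed
  have no6: False if "(a, b) \<in> E" "(c, b) \<in> E" "(c, d) \<in> E" "(e, d) \<in> E" "(e, f) \<in> E" "(a, f) \<in> E"
    "a \<noteq> c" "c \<noteq> e" "a \<noteq> e" "b \<noteq> d" "d \<noteq> f" "b \<noteq> f" for a b c d e f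
  proof -
    have "a \<noteq> d" "b \<noteq> e" "c \<noteq> f" using that EIJ disj by metis+
    then have "is_cycle V ?adj [a, b, c, d, e, f]"
      using that EIJ disj by (auto simp: is_cycle_def is_walk_simps gadj_def V_def)
    then show False using acyc by blast
  qed
  have "3 \<in> D" using Max_in[OF finD neD] maxD by simp
  then obtain u v where uv: "u \<in> V" "v \<in> V" "graph_dist V ?adj u v = 3" by (auto simp: D_def)
  obtain vs where "is_walk V ?adj vs" "hd vs = u" "last vs = v" "length vs = 4"
    using graph_dist_witness[OF conn uv(1,2)] uv(3) by auto
  then obtain a b where walk: "is_walk V ?adj [u, a, b, v]"
    by (auto simp: length_Suc_conv numeral_eq_Suc)
  have na: "\<not> gadj E u v"
    using graph_dist_le[of V ?adj "[u, v]" u v 1] uv by (auto simp: is_walk_simps)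
  \<comment> \<open>The path may start on either side; its vertices are named by side, in the order
    \<open>i1\<close>, \<open>j0\<close>, \<open>i0\<close>, \<open>j1\<close>.\<close>
  obtain i1 j0 i0 j1 where path: "(i1, j0) \<in> E" "(i0, j0) \<in> E" "(i0, j1) \<in> E" "(i1, j1) \<notin> E"
    using walk na EIJ disj by (auto simp: is_walk_simps gadj_def) (metis+)
  \<comment> \<open>Ends of a longest path are leaves: a second neighbour of \<open>i1\<close> would close a cycle of length 4 or 6.\<close>
  have i1_leaf: "j = j0" if j: "(i1, j) \<in> E" for j
  proof (rule ccontr)
    assume "j \<noteq> j0"
    moreover have "j \<noteq> j1" using j path by auto
    ultimately obtain i' where "(i', j) \<in> E" "(i', j1) \<in> E" using two_J[of j j1] EIJ j path by blast
    then show False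
      using no4[of i0 j0 i1 j] no6[of i0 j0 i1 j i' j1] path j \<open>j \<noteq> j0\<close> \<open>j \<noteq> j1\<close> by metis
  qed
  have mem: "i1 \<in> I" "i0 \<in> I" "j0 \<in> J" "j1 \<in> J" using path EIJ by blast+
  have star_I: "(i, j0) \<in> E" if "i \<in> I" for i
  proof (cases "i = i1")
    case False
    then show ?thesis using two_I[of i1 i] i1_leaf mem that by metis
  qed (use path in simp)
  have j1_leaf: "i = i0" if i: "(i, j1) \<in> E" for i
  proof (rule ccontr)
    assume "i \<noteq> i0"
    moreover have "(i, j0) \<in> E" using star_I i EIJ by blast
    moreover have "j0 \<noteq> j1" using path by blast
    ultimately show False using no4[of i0 j0 i j1] path i by blast
  qed
  have star_J: "(i0, j) \<in> E" if "j \<in> J" for j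
  proof (cases "j = j1")
    case False
    then show ?thesis using two_J[of j1 j] j1_leaf mem that by metis
  qed (use path in simp)
  have only: "i = i0 \<or> j = j0" if "(i, j) \<in> E" for i j
    using no4[of i j i0 j0] that star_I[of i] star_J[of j] path EIJ by blast
  show ?thesis
    unfolding I_def[symmetric] J_def[symmetric] using star_I star_J only mem by blast
qed

section \<open>Integrals and barriers\<close>

text \<open>The barrier is put under the continuous part \<open>v = x - w\<close>, since
  \<open>w\<close> may jump. Where \<open>v < - (R + N)\<close>, also \<open>x < - R\<close>, so
  \<open>v\<close> cannot decrease there; hence \<open>v\<close> never falls below
  \<open>- (R + N)\<close>, and \<open>w\<close> costs another \<open>N\<close>.\<close>

lemma barrier_lower:
  fixes h w x :: "real \<Rightarrow> real"
  assumes int: "h integrable_on {0..T}"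
    and x: "\<And>t. t \<in> {0..T} \<Longrightarrow> x t = w t + integral {0..t} h"
    and w: "\<And>t. t \<in> {0..T} \<Longrightarrow> \<bar>w t\<bar> \<le> N"
    and h: "\<And>t. t \<in> {0..T} \<Longrightarrow> x t < - R \<Longrightarrow> 0 \<le> h t"
    and R: "0 \<le> R" and t: "t \<in> {0..T}"
  shows "- (R + 2 * N) \<le> x t"
proof (rule ccontr)
  assume neg: "\<not> - (R + 2 * N) \<le> x t"
  define v where "v s = integral {0..s} h" for s
  have cont: "continuous_on {0..T} v"
    unfolding v_def by (rule indefinite_integral_continuous_1[OF int])
  have N: "0 \<le> N" using w[OF t] by linarith
  have vt: "v t < - (R + N)" using neg x[OF t] w[OF t] by (auto simp: v_def)
  define A where "A = {s \<in> {0..t}. - (R + N) \<le> v s}"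
  have "closed A" unfolding A_def
    by (intro continuous_on_closed_Collect_le continuous_intros continuous_on_subset[OF cont])
      (use t in auto)
  moreover have "0 \<in> A" using t R N by (auto simp: A_def v_def)
  moreover have bdd: "bdd_above A" by (rule bdd_aboveI[of _ t]) (auto simp: A_def)
  ultimately have "Sup A \<in> A" using closed_contains_Sup[of A] by auto
  define s where "s = Sup A"
  have s: "0 \<le> s" "s \<le> t" "- (R + N) \<le> v s" using \<open>Sup A \<in> A\<close> by (auto simp: A_def s_def)
  have above: "0 \<le> h r" if "r \<in> {s<..t}" for r
  proof -
    have "r \<notin> A" using that cSup_upper[OF _ bdd, of r] by (auto simp: s_def)
    then have "v r < - (R + N)" using that s by (auto simp: A_def)
    moreover have "r \<in> {0..T}" using that s t by auto
    ultimately show ?thesis using h[of r] x[of r] w[of r] by (auto simp: v_def)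
  qed
  have "h integrable_on {s..t}" "h integrable_on {0..t}"
    by (rule integrable_on_subinterval[OF int], use s t in auto)+
  then have "v t = v s + integral {s..t} h"
    using Henstock_Kurzweil_Integration.integral_combine[of 0 s t h] s by (simp add: v_def)
  \<comment> \<open>The sign of \<open>h\<close> is known only strictly after \<open>s\<close>, the
    last time above the barrier, so the value at \<open>s\<close> is replaced by 0.\<close>
  moreover have "integral {s..t} h = integral {s..t} (\<lambda>r. if r = s then 0 else h r)"
    by (rule integral_spike[of "{s}"]) auto
  moreover have "0 \<le> integral {s..t} (\<lambda>r. if r = s then 0 else h r)"
  proof (rule integral_nonneg)
    show "(\<lambda>r. if r = s then 0 else h r) integrable_on {s..t}"
      by (rule integrable_spike[OF \<open>h integrable_on {s..t}\<close>, of "{s}"]) auto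
  qed (use above in auto)
  ultimately show False using s vt by linarith
qed

lemma barrier_upper:
  fixes h w x :: "real \<Rightarrow> real"
  assumes int: "h integrable_on {0..T}"
    and x: "\<And>t. t \<in> {0..T} \<Longrightarrow> x t = w t + integral {0..t} h"
    and w: "\<And>t. t \<in> {0..T} \<Longrightarrow> \<bar>w t\<bar> \<le> N"
    and h: "\<And>t. t \<in> {0..T} \<Longrightarrow> x t > R \<Longrightarrow> h t \<le> 0"
    and R: "0 \<le> R" and t: "t \<in> {0..T}"
  shows "x t \<le> R + 2 * N"
  using barrier_lower[of "\<lambda>s. - h s" T "\<lambda>s. - x s" "\<lambda>s. - w s" N R t] assms
  by (auto simp: integrable_neg)

text \<open>Passes from the Lebesgue integral in \<open>Jint\<close> to the Henstock-Kurzweil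
  integral of the estimates; boundedness supplies integrability.\<close>

lemma meas_locbdd_integral:
  assumes f: "meas_locbdd S f" and S: "{0..t} \<subseteq> S"
  shows "f integrable_on {0..t}" "Jint f t = integral {0..t} f"
proof -
  have "set_integrable lborel {0..t} f"
  proof (cases "0 \<le> t")
    case True
    then obtain B where B: "\<And>s. s \<in> {0..t} \<Longrightarrow> \<bar>f s\<bar> \<le> B"
      using f S unfolding meas_locbdd_def by (meson atLeastAtMost_iff order_refl subsetD)
    have "set_borel_measurable lborel {0..t} f"
      using f S set_borel_measurable_subset[of lborel S f "{0..t}"] by (auto simp: meas_locbdd_def)
    then show ?thesis unfolding set_integrable_def set_borel_measurable_def
      by (intro integrableI_bounded_set[where A = "{0..t}" and B = B])
        (use B in \<open>auto simp: indicator_def emeasure_lborel_Icc_eq\<close>)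
  qed (simp add: set_integrable_def)
  then show "f integrable_on {0..t}" "Jint f t = integral {0..t} f"
    by (auto simp: Jint_def intro: set_borel_integral_eq_integral)
qed

lemma continuous_on_meas_locbdd:
  fixes f :: "real \<Rightarrow> real"
  assumes "continuous_on {0..T} f"
  shows "meas_locbdd {0..<T} f"
proof -
  have "set_borel_measurable lborel {0..<T} f"
    using borel_measurable_continuous_on_indicator[of "{0..<T}" f]
      continuous_on_subset[OF assms, of "{0..<T}"] atLeastLessThan_subseteq_atLeastAtMost_iff[of 0 T 0 T]
    by (simp add: set_borel_measurable_def)
  moreover have "\<exists>B. \<forall>s\<in>{0..t}. \<bar>f s\<bar> \<le> B" if "t \<in> {0..<T}" for t
  proof -
    have "bounded (f ` {0..t})"
      by (intro compact_imp_bounded compact_continuous_image continuous_on_subset[OF assms])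
        (use that in auto)
    then show ?thesis by (auto simp: bounded_iff)
  qed
  ultimately show ?thesis by (auto simp: meas_locbdd_def)
qed

section \<open>Consequences of the nonidling property\<close>

text \<open>By contradiction: class \<open>i\<close> decays at a rate \<open>a\<close> below its
  service rate, and its mass is compensated in class \<open>k\<close>, whose smaller service rate
  leaves a margin in the growth of \<open>w k\<close>. As \<open>a < \<theta> k\<close>, the
  positive part of the total can decay faster than rate \<open>a\<close>, and the margin pays for a
  negative part with rate \<open>a\<close>.\<close>

lemma nonidling_abandonment_bound:
  assumes mu_pos: "\<And>i. i \<in> Iset nI \<Longrightarrow> \<mu> i j0 > 0"
    and nonidl: "nonidling nI nJ E \<mu> \<theta>"
    and j0: "j0 \<in> Jset nI nJ" and adj: "\<And>i. i \<in> Iset nI \<Longrightarrow> (i, j0) \<in> E"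
    and ik: "i \<in> Iset nI" "k \<in> Iset nI" and less: "\<mu> k j0 < \<mu> i j0"
  shows "\<theta> k \<le> \<mu> k j0"
proof (rule ccontr)
  define I where "I = Iset nI"
  define J where "J = Jset nI nJ"
  have fin: "finite I" "finite J" by (auto simp: I_def J_def Iset_def Jset_def)
  define m where "m r = \<mu> r j0" for r
  have m_pos: "m r > 0" if "r \<in> I" for r using mu_pos that by (simp add: m_def I_def)
  assume "\<not> \<theta> k \<le> \<mu> k j0"
  then have "m k < min (m i) (\<theta> k)" using less by (simp add: m_def)
  then obtain a where a: "m k < a" "a < m i" "a < \<theta> k" using dense[of "m k" "min (m i) (\<theta> k)"] by auto
  then obtain p where p: "a < p" "p < \<theta> k" using dense by blast
  \<comment> \<open>\<open>c\<close> is the coefficient of \<open>exp (- a * t)\<close> gained in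
    class \<open>k\<close>; \<open>b\<close> spends half of it on the negative part of
    \<open>X\<close>, and the other half covers \<open>\<epsilon>\<close>.\<close>
  define c where "c = a - m k"
  define b where "b = c / (2 * (\<theta> k - a))"
  have c: "c > 0" and b: "b > 0" "b * (\<theta> k - a) = c / 2" using a by (auto simp: b_def c_def field_simps)
  \<comment> \<open>\<open>X\<close> will be the sum of all \<open>x r\<close>. It becomes negative because \<open>a < p\<close>, and it satisfies
    \<open>X' + \<theta> k * X > - c * exp (- a * t)\<close>, which up to small terms says that \<open>w k\<close> increases. The trajectory
    is prescribed first; \<open>w\<close> is then read off from (S1), so no differential equation has to be solved.\<close>
  define X where "X t = (2 + b) * exp (- p * t) - b * exp (- a * t)" for t :: real
  \<comment> \<open>By \<open>exp u \<ge> 1 + u\<close> with \<open>u = (2 + b) / b\<close>, the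
    term with the slower decay rate \<open>a\<close> has won by time \<open>t0\<close>.\<close>
  define t0 where "t0 = ((2 + b) / b) / (p - a)"
  have t0: "t0 > 0" using b p by (simp add: t0_def)
  have "X t0 < 0"
  proof -
    have "(2 + b) / b < exp ((p - a) * t0)"
      using exp_ge_add_one_self[of "(2 + b) / b"] p unfolding t0_def by (simp del: exp_ge_add_one_self)
    then have "2 + b < b * exp ((p - a) * t0)" using b by (simp add: field_simps)
    then have "(2 + b) * exp (- p * t0) < b * exp ((p - a) * t0) * exp (- p * t0)" by simp
    also have "\<dots> = b * exp (- a * t0)" by (simp add: mult_exp_exp algebra_simps)
    finally show ?thesis by (simp add: X_def)
  qed
  define T where "T = t0 + 1"
  define Rest where "Rest = I - {i, k}"
  define d where "d = real (card Rest)"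
  \<comment> \<open>The bound 1/2 keeps \<open>w k 0 = 1 - d * \<epsilon>\<close> positive; the
    other bound keeps \<open>m k * (d * \<epsilon>)\<close> below the remaining half of the margin
    up to \<open>T\<close>. The denominator \<open>d + 1\<close> is nonzero even when
    \<open>Rest\<close> is empty.\<close>
  define \<epsilon> where "\<epsilon> = min (1 / 2) (c / 4 * exp (- a * T)/ m k) / (d + 1)"
  have kI: "k \<in> I" "i \<in> I" "i \<noteq> k" using ik less by (auto simp: I_def)
  have d: "d \<ge> 0" by (simp add: d_def)
  have eps: "\<epsilon> > 0" using c m_pos[OF kI(1)] d by (simp add: \<epsilon>_def)
  have deps: "d * \<epsilon> \<le> min (1 / 2) (c / 4 * exp (- a * T)/ m k)"
  proof -
    have "d * \<epsilon> \<le> (d + 1) * \<epsilon>" using eps by simp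
    also have "\<dots> = min (1 / 2) (c / 4 * exp (- a * T)/ m k)" using d by (simp add: \<epsilon>_def)
    finally show ?thesis .
  qed
  have deps1: "d * \<epsilon> < 1" using deps by simp
  have "d * \<epsilon> \<le> c / 4 * exp (- a * T)/ m k" using deps by simp
  then have "m k * (d * \<epsilon>) \<le> m k * (c / 4 * exp (- a * T) / m k)"
    using m_pos[OF kI(1)] by (intro mult_left_mono) auto
  also have "\<dots> < c / 2 * exp (- a * T)" using m_pos[OF kI(1)] c by simp
  finally have deps2: "m k * (d * \<epsilon>) < c / 2 * exp (- a * T)" .
  \<comment> \<open>The classes in \<open>Rest\<close> stay constant, and \<open>x k\<close> makes
    the total equal to \<open>X\<close>. The system puts no sign on \<open>x\<close> or
    \<open>\<psi>\<close>, and \<open>x k\<close> does become negative.\<close>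
  define x where "x r t = (if r = i then exp (- a * t) else if r = k then X t - exp (- a * t) - d * \<epsilon> else \<epsilon>)"
    for r :: nat and t :: real
  define y where "y r t = (if r = k then max (X t) 0 else 0)" for r :: nat and t :: real
  define z where "z j t = (if j = j0 then max (- X t) 0 else 0)" for j :: nat and t :: real
  define \<psi> where "\<psi> r j t = (if j = j0 then x r t - y r t else 0)" for r j :: nat and t :: real
  define g where "g r s = m r * (x r s - y r s) + \<theta> r * y r s" for r s
  define w where "w r t = x r t + integral {0..t} (g r)" for r t
  have contX: "continuous_on A X" for A unfolding X_def by (intro continuous_intros)
  have contx: "continuous_on A (x r)" for r A unfolding x_def
    by (cases "r = i"; cases "r = k") (auto intro!: continuous_intros contX)
  have conty: "continuous_on A (y r)" for r A unfolding y_def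
    by (cases "r = k") (auto intro!: continuous_intros contX)
  have contz: "continuous_on A (z j)" for j A unfolding z_def
    by (cases "j = j0") (auto intro!: continuous_intros contX)
  have contpsi: "continuous_on A (\<psi> r j)" for r j A unfolding \<psi>_def
    by (cases "j = j0") (auto intro!: continuous_intros contx conty)
  have contg: "continuous_on A (g r)" for r A unfolding g_def
    by (auto intro!: continuous_intros contx conty)
  have contw: "continuous_on {0..T} (w r)" for r unfolding w_def
    by (intro continuous_intros contx indefinite_integral_continuous_1 integrable_continuous_interval contg)
  have sum_x: "(\<Sum>r\<in>I. x r t) = X t" for t
  proof -
    have "(\<Sum>r\<in>I. x r t) = (\<Sum>r\<in>Rest. x r t) + (x i t + x k t)"
      unfolding Rest_def using fin kI sum.subset_diff[of "{i, k}" I "\<lambda>r. x r t"] by simp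
    also have "(\<Sum>r\<in>Rest. x r t) = d * \<epsilon>"
      by (simp add: Rest_def x_def d_def sum.cong[of Rest Rest _ "\<lambda>_. \<epsilon>"])
    also have "d * \<epsilon> + (x i t + x k t) = X t" using kI by (simp add: x_def)
    finally show ?thesis .
  qed
  have sum_y: "(\<Sum>r\<in>I. y r t) = max (X t) 0" for t using fin kI by (simp add: y_def)
  have sum_z: "(\<Sum>j\<in>J. z j t) = max (- X t) 0" for t using fin j0 by (simp add: z_def J_def)
  have Jint: "Jint f t = integral {0..t} f" if "t \<in> {0..<T}" "continuous_on {0..T} f" for f t
    by (rule meas_locbdd_integral[OF continuous_on_meas_locbdd[OF that(2)]]) (use that in auto)
  have S1: "(\<Sum>j\<in>J. \<psi> r j t + \<mu> r j * Jint (\<psi> r j) t) = w r t - y r t - \<theta> r * Jint (y r) t"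
    if t: "t \<in> {0..<T}" for r t
  proof -
    have "\<psi> r j t + \<mu> r j * Jint (\<psi> r j) t =
        (if j = j0 then x r t - y r t + m r * integral {0..t} (\<lambda>s. x r s - y r s) else 0)" for j
    proof -
      have "\<psi> r j = (if j = j0 then (\<lambda>s. x r s - y r s) else (\<lambda>_. 0))" by (auto simp: \<psi>_def)
      then show ?thesis using Jint[OF t contpsi, of r j] by (auto simp: m_def)
    qed
    then have "(\<Sum>j\<in>J. \<psi> r j t + \<mu> r j * Jint (\<psi> r j) t) =
        x r t - y r t + m r * integral {0..t} (\<lambda>s. x r s - y r s)"
      using fin j0 by (simp add: J_def)
    moreover have "integral {0..t} (g r) =
        m r * integral {0..t} (\<lambda>s. x r s - y r s) + \<theta> r * integral {0..t} (y r)"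
      unfolding g_def
      by (subst integral_add)
        (auto intro!: integrable_continuous_interval continuous_intros contx conty)
    ultimately show ?thesis using Jint[OF t conty, of r] by (simp add: w_def)
  qed
  have sys: "system_on nI nJ E \<mu> \<theta> {0..<T} \<psi> y z w"
    unfolding system_on_def I_def[symmetric] J_def[symmetric]
  proof (intro conjI ballI impI)
    fix j t assume "j \<in> J"
    show "(\<Sum>r\<in>I. \<psi> r j t) = - z j t"
      by (cases "j = j0") (auto simp: \<psi>_def z_def sum_subtractf sum_x sum_y)
  next
    fix r j t assume "r \<in> I" "(r, j) \<notin> E"
    then show "\<psi> r j t = 0" using adj by (auto simp: \<psi>_def I_def)
  next
    fix t show "min (\<Sum>r\<in>I. y r t) (\<Sum>j\<in>J. z j t) = 0" unfolding sum_y sum_z by auto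
  qed (auto simp: S1 y_def z_def intro!: continuous_on_meas_locbdd contw conty contz contpsi)
  \<comment> \<open>Only \<open>x\<close> is differentiated; the kink of \<open>max (X t) 0\<close>
    enters through the integral of the continuous function \<open>g\<close>.\<close>
  define x' where "x' r t = (if r = i then - a * exp (- a * t)
      else if r = k then (2 + b) * (- p * exp (- p * t)) - b * (- a * exp (- a * t)) + a * exp (- a * t) else 0)"
    for r :: nat and t :: real
  have der: "(x r has_real_derivative x' r t) (at t)" for r t
    unfolding x_def x'_def X_def
    by (cases "r = i"; cases "r = k") (auto intro!: derivative_eq_intros simp: algebra_simps)
  have pos: "x' r t + g r t > 0" if r: "r \<in> I" and t: "0 < t" "t < T" for r t
  proof -
    consider "r = i" | "r = k" | "r \<noteq> i" "r \<noteq> k" by blast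
    then show ?thesis
    proof cases
      case 1
      then have "x' r t + g r t = (m i - a) * exp (- a * t)"
        using kI by (simp add: x'_def g_def x_def y_def algebra_simps)
      then show ?thesis using a by simp
    next
      case 2
      have "exp (- a * T) \<le> exp (- a * t)" using a m_pos[OF kI(1)] t by simp
      then have e: "m k * (d * \<epsilon>) < c / 2 * exp (- a * t)"
        using deps2 c by (smt (verit) mult_left_mono divide_pos_pos)
      \<comment> \<open>The first term is positive by \<open>p < \<theta> k\<close>; the second has
        coefficient \<open>c / 2\<close> by the choice of \<open>b\<close> and outweighs the last
        one.\<close>
      have "x' r t + g r t = (2 + b) * (\<theta> k - p) * exp (- p * t) + (c - b * (\<theta> k - a)) * exp (- a * t)
          + (\<theta> k - m k) * (max (X t) 0 - X t) - m k * (d * \<epsilon>)"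
        using 2 kI by (simp add: x'_def g_def x_def y_def X_def c_def algebra_simps)
      moreover have "(2 + b) * (\<theta> k - p) * exp (- p * t) > 0" using b p by simp
      moreover have "(\<theta> k - m k) * (max (X t) 0 - X t) \<ge> 0" using a by simp
      ultimately show ?thesis using e b by simp
    next
      case 3
      then show ?thesis using m_pos[OF r] eps by (simp add: x'_def g_def x_def y_def)
    qed
  qed
  have mono: "strict_mono_on {0..<T} (w r)" if r: "r \<in> I" for r
  proof (rule strict_mono_onI)
    fix s t assume st: "s \<in> {0..<T}" "t \<in> {0..<T}" "s < t"
    show "w r s < w r t"
    proof (rule DERIV_pos_imp_increasing_open[OF st(3)])
      fix u assume u: "s < u" "u < t"
      then have u': "0 < u" "u < T" using st by auto
      then have "((\<lambda>t. integral {0..t} (g r)) has_real_derivative g r u) (at u)"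
        using integral_has_real_derivative[OF contg[of "{0..T}" r], of u] at_within_Icc_at[of 0 u T] by simp
      then have "(w r has_real_derivative x' r u + g r u) (at u)"
        unfolding w_def by (intro DERIV_add der)
      then show "\<exists>D. (w r has_real_derivative D) (at u) \<and> 0 < D" using pos[OF r u'] by blast
    qed (use st in \<open>auto intro: continuous_on_subset[OF contw]\<close>)
  qed
  have rcont: "continuous (at_right t) (w r)" if t: "t \<in> {0..<T}" for r t
  proof -
    have "continuous (at t within {t..T}) (w r)"
      using contw[of r] t unfolding continuous_on_eq_continuous_within
      by (intro continuous_within_subset[of t "{0..T}" "w r" "{t..T}"]) auto
    then show ?thesis using at_within_Icc_at_right[of t T] t by simp
  qed
  have w0: "w r 0 > 0" if "r \<in> I" for r
    using deps1 eps by (simp add: w_def x_def X_def)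
  have "z j0 t0 = 0"
    using nonidl[unfolded nonidling_def, rule_format, of T \<psi> y z w t0 j0] sys mono rcont w0 t0 j0
    by (auto simp: T_def I_def)
  then show False using \<open>X t0 < 0\<close> by (simp add: z_def)
qed

section \<open>Growth of a trajectory on a double star\<close>

text \<open>In the application \<open>m i = \<mu> i j0\<close>, \<open>\<nu> j = \<mu> i0 j\<close>,
  and \<open>a\<close> is the largest \<open>m i\<close>; \<open>abandon\<close> is what nonidling
  provides.\<close>

locale double_star =
  fixes I J :: "nat set" and i0 :: nat and m \<theta> \<nu> :: "nat \<Rightarrow> real" and a :: real
  assumes fin: "finite I" "finite J" and i0: "i0 \<in> I"
    and m_pos: "\<And>i. i \<in> I \<Longrightarrow> 0 < m i" and theta_nonneg: "\<And>i. i \<in> I \<Longrightarrow> 0 \<le> \<theta> i"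
    and nu_pos: "\<And>j. j \<in> J \<Longrightarrow> 0 < \<nu> j"
    and m_le: "\<And>i. i \<in> I \<Longrightarrow> m i \<le> a"
    and abandon: "\<And>i. i \<in> I \<Longrightarrow> m i < a \<Longrightarrow> \<theta> i \<le> m i"
begin

text \<open>The rate of change of \<open>x i - w i\<close> after eliminating \<open>\<psi>\<close>:
  a pool other than \<open>j0\<close> serves only \<open>i0\<close>, so
  \<open>\<psi> i0 j = - z j\<close>. In the application \<open>\<nu> j0 = m i0\<close>, so
  \<open>j0\<close> contributes nothing to the sum.\<close>

definition drift :: "(nat \<Rightarrow> real \<Rightarrow> real) \<Rightarrow> (nat \<Rightarrow> real \<Rightarrow> real) \<Rightarrow> (nat \<Rightarrow> real \<Rightarrow> real) \<Rightarrow> nat \<Rightarrow> real \<Rightarrow> real"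
  where "drift x y z i s = - m i * x i s + (m i - \<theta> i) * y i s
           + (if i = i0 then \<Sum>j\<in>J. (\<nu> j - m i0) * z j s else 0)"

text \<open>Inserting 1 keeps the minimum meaningful and makes \<open>slack\<close> nonnegative.\<close>

definition slack :: real where
  "slack = 1 - Min (insert 1 ((\<lambda>j. \<nu> j / m i0) ` J))"

definition rate_ratio :: real where
  "rate_ratio = (\<Sum>j\<in>J. \<nu> j / m i0)"

definition inv_rates :: real where
  "inv_rates = (\<Sum>i\<in>I. 1 / m i)"

text \<open>The fixed point of \<open>M = 4 * card I * N + slack * M\<close> is
  \<open>idle_const * N\<close>.\<close>

definition idle_const :: real where
  "idle_const = 4 * card I / (1 - slack)"

text \<open>Adds the constants of the lower and upper bounds of the total, so that it dominates
  both.\<close>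

definition total_const :: real where
  "total_const = idle_const + a * ((inv_rates + rate_ratio * idle_const) + (idle_const + 2) * inv_rates)"

definition growth_const :: real where
  "growth_const = (\<Sum>i\<in>I. (m i + \<theta> i + m i0 * (rate_ratio + 1)) * total_const / m i + 2)"

section \<open>Signs and comparisons of the constants\<close>

lemma slack: "0 \<le> slack" "slack < 1" "j \<in> J \<Longrightarrow> (1 - slack) * m i0 \<le> \<nu> j"
proof -
  let ?S = "insert 1 ((\<lambda>j. \<nu> j / m i0) ` J)"
  have S: "finite ?S" "?S \<noteq> {}" using fin by auto
  show "0 \<le> slack" using Min_le[OF S(1), of 1] by (simp add: slack_def)
  have "0 < Min ?S" using S nu_pos m_pos[OF i0] by (subst Min_gr_iff) auto
  then show "slack < 1" by (simp add: slack_def)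
  assume "j \<in> J"
  then have "1 - slack \<le> \<nu> j / m i0" unfolding slack_def using Min_le[OF S(1), of "\<nu> j / m i0"] by (smt (verit) image_eqI insertI2)
  then show "(1 - slack) * m i0 \<le> \<nu> j" using m_pos[OF i0] by (simp add: field_simps)
qed

lemma a_pos: "0 < a"
  using m_pos[OF i0] m_le[OF i0] by linarith

lemma rate_ratio: "0 \<le> rate_ratio" "j \<in> J \<Longrightarrow> \<nu> j \<le> rate_ratio * m i0"
proof -
  have nonneg: "0 \<le> \<nu> j / m i0" if "j \<in> J" for j
    using nu_pos[OF that] m_pos[OF i0] by simp
  then show "0 \<le> rate_ratio" by (auto simp: rate_ratio_def intro: sum_nonneg)
  assume "j \<in> J"
  then have "\<nu> j / m i0 \<le> rate_ratio"
    unfolding rate_ratio_def using nonneg fin by (intro member_le_sum) auto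
  then show "\<nu> j \<le> rate_ratio * m i0" using m_pos[OF i0] by (simp add: field_simps)
qed

lemma inv_rates_nonneg: "0 \<le> inv_rates"
  unfolding inv_rates_def using m_pos by (intro sum_nonneg) (simp add: less_imp_le)

lemma idle_const_nonneg: "0 \<le> idle_const"
  unfolding idle_const_def using slack by simp

lemma total_const_ge:
  "idle_const \<le> total_const"
  "a * ((inv_rates + rate_ratio * idle_const) + (idle_const + 2) * inv_rates) \<le> total_const"
  unfolding total_const_def
  using idle_const_nonneg inv_rates_nonneg rate_ratio(1) a_pos by simp_all

lemma growth_const_nonneg: "0 \<le> growth_const"
  unfolding growth_const_def
proof (intro sum_nonneg)
  fix i assume i: "i \<in> I"
  have "0 \<le> total_const" using total_const_ge idle_const_nonneg by linarith
  then have "0 \<le> (m i + \<theta> i + m i0 * (rate_ratio + 1)) * total_const / m i"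
    using m_pos[OF i] m_pos[OF i0] theta_nonneg[OF i] rate_ratio(1) by simp
  then show "0 \<le> (m i + \<theta> i + m i0 * (rate_ratio + 1)) * total_const / m i + 2" by simp
qed

end

text \<open>\<open>T\<close> is the time at which growth is read off, so \<open>N\<close> may be the
  supremum norm of \<open>w\<close> up to that time.\<close>

locale double_star_trajectory = double_star +
  fixes T N :: real and x w y z :: "nat \<Rightarrow> real \<Rightarrow> real"
  assumes T: "0 \<le> T"
    and drift_int: "\<And>i. i \<in> I \<Longrightarrow> drift x y z i integrable_on {0..T}"
    and x_eq: "\<And>i t. i \<in> I \<Longrightarrow> t \<in> {0..T} \<Longrightarrow> x i t = w i t + integral {0..t} (drift x y z i)"
    and w_le: "\<And>i t. i \<in> I \<Longrightarrow> t \<in> {0..T} \<Longrightarrow> \<bar>w i t\<bar> \<le> N"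
    and y_nonneg: "\<And>i t. i \<in> I \<Longrightarrow> t \<in> {0..T} \<Longrightarrow> 0 \<le> y i t"
    and z_nonneg: "\<And>j t. j \<in> J \<Longrightarrow> t \<in> {0..T} \<Longrightarrow> 0 \<le> z j t"
    and sum_y: "\<And>t. t \<in> {0..T} \<Longrightarrow> (\<Sum>i\<in>I. y i t) = max (\<Sum>i\<in>I. x i t) 0"
    and sum_z: "\<And>t. t \<in> {0..T} \<Longrightarrow> (\<Sum>j\<in>J. z j t) = max (- (\<Sum>i\<in>I. x i t)) 0"
begin

abbreviation h where "h \<equiv> drift x y z"

definition X where "X t = (\<Sum>i\<in>I. x i t)"

lemma N_nonneg: "0 \<le> N"
  using w_le[OF i0, of 0] T by auto

lemma y_le: "i \<in> I \<Longrightarrow> t \<in> {0..T} \<Longrightarrow> y i t \<le> max (X t) 0"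
  using member_le_sum[of i I "\<lambda>i. y i t"] y_nonneg fin sum_y[of t] by (simp add: X_def)

lemma y_zero: "i \<in> I \<Longrightarrow> t \<in> {0..T} \<Longrightarrow> X t \<le> 0 \<Longrightarrow> y i t = 0"
  using y_le[of i t] y_nonneg[of i t] by simp

lemma sum_z_eq: "t \<in> {0..T} \<Longrightarrow> (\<Sum>j\<in>J. z j t) = max (- X t) 0"
  unfolding X_def by (rule sum_z)

text \<open>Every coefficient is at least \<open>- slack * m i0\<close>, and the \<open>z j\<close>
  add up to the negative part of \<open>X\<close>.\<close>

lemma idle_drift_ge:
  assumes "t \<in> {0..T}"
  shows "- (slack * m i0 * max (- X t) 0) \<le> (\<Sum>j\<in>J. (\<nu> j - m i0) * z j t)"
proof -
  have "- (slack * m i0 * max (- X t) 0) = (\<Sum>j\<in>J. - (slack * m i0) * z j t)"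
    unfolding sum_distrib_left[symmetric] sum_z_eq[OF assms] by simp
  also have "\<dots> \<le> (\<Sum>j\<in>J. (\<nu> j - m i0) * z j t)"
    using slack(3) z_nonneg assms by (intro sum_mono mult_right_mono) (auto simp: algebra_simps)
  finally show ?thesis .
qed

lemma weighted_sum_eq:
  assumes "t \<in> {0..T}"
  shows "(\<Sum>i\<in>I. c i * x i t) = (\<Sum>i\<in>I. c i * w i t) + integral {0..t} (\<lambda>s. \<Sum>i\<in>I. c i * h i s)"
    and "(\<lambda>s. \<Sum>i\<in>I. c i * h i s) integrable_on {0..T}"
proof -
  have int: "h i integrable_on {0..t}" if "i \<in> I" for i
    using integrable_on_subinterval[OF drift_int[OF that], of 0 t] assms by auto
  have "integral {0..t} (\<lambda>s. \<Sum>i\<in>I. c i * h i s) = (\<Sum>i\<in>I. c i * integral {0..t} (h i))"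
    using fin int by (subst integral_sum) (auto intro: integrable_on_mult_right)
  then show "(\<Sum>i\<in>I. c i * x i t) = (\<Sum>i\<in>I. c i * w i t) + integral {0..t} (\<lambda>s. \<Sum>i\<in>I. c i * h i s)"
    using x_eq assms by (simp add: algebra_simps flip: sum.distrib)
  show "(\<lambda>s. \<Sum>i\<in>I. c i * h i s) integrable_on {0..T}"
    using fin drift_int by (intro integrable_sum integrable_on_mult_right) auto
qed

section \<open>Lower bounds for the slow classes and the total\<close>

text \<open>Purely qualitative: it makes the supremum in \<open>X_lower\<close> finite before that
  supremum is estimated.\<close>

lemma X_bounded_below: "\<exists>B. \<forall>t\<in>{0..T}. - B \<le> X t"
proof -
  let ?v = "\<lambda>t. integral {0..t} (\<lambda>s. \<Sum>i\<in>I. 1 * h i s)"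
  have "continuous_on {0..T} ?v"
    using T by (intro indefinite_integral_continuous_1 weighted_sum_eq(2)[of 0]) auto
  then have "bounded (?v ` {0..T})" by (intro compact_imp_bounded compact_continuous_image) auto
  then obtain B where "\<forall>t\<in>{0..T}. \<bar>?v t\<bar> \<le> B" by (auto simp: bounded_iff)
  then have B: "\<bar>?v t\<bar> \<le> B" if "t \<in> {0..T}" for t using that by blast
  have "- (card I * N + B) \<le> X t" if t: "t \<in> {0..T}" for t
  proof -
    have "(\<Sum>i\<in>I. - N) \<le> (\<Sum>i\<in>I. w i t)" using w_le t by (intro sum_mono) (smt (verit))
    then show ?thesis using weighted_sum_eq(1)[OF t, of "\<lambda>_. 1"] B[OF t] by (simp add: X_def)
  qed
  then show ?thesis by blast
qed

text \<open>By \<open>abandon\<close> the queue term only pushes a slow class up. For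
  \<open>i0\<close>, idleness pulls down by at most \<open>slack * m i0 * M\<close>, which the
  restoring term \<open>- m i0 * x i0\<close> outweighs below \<open>- slack * M\<close>.\<close>

lemma slow_x_lower:
  assumes X: "\<And>t. t \<in> {0..T} \<Longrightarrow> - M \<le> X t" and M: "0 \<le> M"
    and i: "i \<in> I" "m i < a" and t: "t \<in> {0..T}"
  shows "- ((if i = i0 then slack * M else 0) + 2 * N) \<le> x i t"
proof (rule barrier_lower[OF drift_int[OF i(1)] x_eq[OF i(1)] w_le[OF i(1)] _ _ t])
  show "0 \<le> (if i = i0 then slack * M else 0)" using slack M by simp
  fix s assume s: "s \<in> {0..T}" and xs: "x i s < - (if i = i0 then slack * M else 0)"
  have y: "0 \<le> (m i - \<theta> i) * y i s" using abandon[OF i] y_nonneg[OF i(1) s] by simp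
  show "0 \<le> h i s"
  proof (cases "i = i0")
    case True
    have "slack * m i0 * max (- X s) 0 \<le> slack * m i0 * M"
      using slack m_pos[OF i0] X[OF s] M by (intro mult_left_mono) auto
    moreover have "m i0 * (slack * M) \<le> m i0 * (- x i s)"
      using xs True m_pos[OF i0] by (intro mult_left_mono) auto
    ultimately show ?thesis using True y idle_drift_ge[OF s] by (simp add: drift_def algebra_simps)
  next
    case False
    then have "m i * x i s \<le> 0" using xs m_pos[OF i(1)] by (simp add: mult_nonneg_nonpos)
    then show ?thesis using False y by (simp add: drift_def)
  qed
qed

text \<open>The factor \<open>slack < 1\<close> in front of \<open>M\<close> makes this self-improving in \<open>M\<close>.\<close>

lemma X_lower_step:
  assumes X: "\<And>t. t \<in> {0..T} \<Longrightarrow> - M \<le> X t" and M: "0 \<le> M" and t: "t \<in> {0..T}"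
  shows "- (4 * card I * N + slack * M) \<le> X t"
proof -
  let ?n = "real (card I)"
  let ?h = "\<lambda>s. \<Sum>i\<in>I. 1 * h i s"
  have "- ((2 * ?n * N + slack * M) + 2 * (?n * N)) \<le> X t"
  proof (rule barrier_lower[of ?h T X "\<lambda>s. \<Sum>i\<in>I. w i s"])
    show "?h integrable_on {0..T}" by (rule weighted_sum_eq(2)[OF t])
    show "X s = (\<Sum>i\<in>I. w i s) + integral {0..s} ?h" if "s \<in> {0..T}" for s
      using weighted_sum_eq(1)[OF that, of "\<lambda>_. 1"] by (simp add: X_def)
    show "\<bar>\<Sum>i\<in>I. w i s\<bar> \<le> ?n * N" if "s \<in> {0..T}" for s
      using sum_bounded_above[of I "\<lambda>i. \<bar>w i s\<bar>" N, OF w_le[OF _ that]]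
        sum_abs[of "\<lambda>i. w i s" I] by linarith
    show "0 \<le> 2 * ?n * N + slack * M" using slack M N_nonneg by simp
    fix s assume s: "s \<in> {0..T}" and Xs: "X s < - (2 * ?n * N + slack * M)"
    have neg: "X s \<le> 0" using Xs slack M N_nonneg
      by (smt (verit) mult_nonneg_nonneg of_nat_0_le_iff)
    \<comment> \<open>With \<open>X s \<le> 0\<close> there is no queue. Splitting off
      \<open>a * X s\<close> leaves coefficients \<open>a - m i\<close>, which vanish for the
      fastest classes, so bounds on slow classes suffice.\<close>
    have eq: "?h s = (\<Sum>i\<in>I. (a - m i) * x i s) - a * X s + (\<Sum>j\<in>J. (\<nu> j - m i0) * z j s)"
      using y_zero[OF _ s neg] fin i0
      by (simp add: drift_def X_def sum.distrib sum_subtractf sum_negf sum_distrib_left algebra_simps)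
    have "slack * m i0 * max (- X s) 0 \<le> slack * m i0 * M"
      using slack m_pos[OF i0] X[OF s] M by (intro mult_left_mono) auto
    then have idle: "- (slack * m i0 * M) \<le> (\<Sum>j\<in>J. (\<nu> j - m i0) * z j s)"
      using idle_drift_ge[OF s] by linarith
    have "(\<Sum>i\<in>I. - (2 * a * N) - (if i = i0 then (a - m i0) * (slack * M) else 0))
        \<le> (\<Sum>i\<in>I. (a - m i) * x i s)"
    proof (rule sum_mono)
      fix i assume i: "i \<in> I"
      show "- (2 * a * N) - (if i = i0 then (a - m i0) * (slack * M) else 0) \<le> (a - m i) * x i s"
      proof (cases "m i < a")
        case True
        have "(a - m i) * - ((if i = i0 then slack * M else 0) + 2 * N) \<le> (a - m i) * x i s"
          using slow_x_lower[OF X M i True s] True by (intro mult_left_mono) auto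
        moreover have "0 \<le> m i * N" using m_pos[OF i] N_nonneg by simp
        ultimately show ?thesis by (auto simp: algebra_simps split: if_splits)
      next
        case False
        then show ?thesis using m_le[OF i] a_pos N_nonneg slack M m_le[OF i0] by (auto simp: order_antisym)
      qed
    qed
    then have "- (?n * (2 * a * N)) - (a - m i0) * (slack * M) \<le> (\<Sum>i\<in>I. (a - m i) * x i s)"
      using fin i0 by (simp add: sum_subtractf sum_negf)
    \<comment> \<open>The barrier level is chosen so that this gain exactly cancels the losses from
      the slow classes and from idleness.\<close>
    moreover have "a * (2 * ?n * N + slack * M) \<le> a * - X s"
      using Xs a_pos by (intro mult_left_mono) auto
    ultimately show "0 \<le> ?h s" unfolding eq using idle by (simp add: algebra_simps)
  qed (use t in auto)
  then show ?thesis by (simp add: algebra_simps)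
qed

text \<open>For the supremum \<open>M\<close> of the negative part, \<open>X_lower_step\<close>
  gives \<open>M \<le> 4 * card I * N + slack * M\<close>, which can be solved because
  \<open>M\<close> is finite and \<open>slack < 1\<close>.\<close>

lemma X_lower:
  assumes t: "t \<in> {0..T}"
  shows "- (idle_const * N) \<le> X t"
proof -
  define M where "M = (SUP s\<in>{0..T}. max (- X s) 0)"
  obtain B where B: "\<And>s. s \<in> {0..T} \<Longrightarrow> - B \<le> X s" using X_bounded_below by blast
  have bdd: "bdd_above ((\<lambda>s. max (- X s) 0) ` {0..T})"
    by (rule bdd_aboveI2[of _ _ "max B 0"]) (use B in force)
  have M: "max (- X s) 0 \<le> M" if "s \<in> {0..T}" for s
    unfolding M_def using that bdd by (intro cSUP_upper)
  have M0: "0 \<le> M" using M[of 0] T by auto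
  have "M \<le> 4 * card I * N + slack * M" unfolding M_def
  proof (rule cSUP_least)
    fix s assume s: "s \<in> {0..T}"
    have "- (4 * card I * N + slack * M) \<le> X s"
    proof (rule X_lower_step[OF _ M0 s])
      show "- M \<le> X r" if "r \<in> {0..T}" for r using M[OF that] by linarith
    qed
    then show "max (- X s) 0 \<le> 4 * card I * N + slack * (SUP s\<in>{0..T}. max (- X s) 0)"
      using N_nonneg slack M0 by (simp flip: M_def)
  qed (use T in auto)
  then have "M \<le> idle_const * N" using slack by (simp add: idle_const_def field_simps)
  then show ?thesis using M[OF t] by linarith
qed

lemma sum_z_le: "t \<in> {0..T} \<Longrightarrow> (\<Sum>j\<in>J. z j t) \<le> idle_const * N"
  using X_lower[of t] sum_z[of t] idle_const_nonneg N_nonneg by (simp add: X_def)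

section \<open>Workload and upper bound for the total\<close>

text \<open>The weights \<open>1 / m i\<close> turn the service terms into total queue minus
  \<open>X\<close>, which is total idleness. Abandonment only lowers the workload, so its growth
  rate is bounded through idleness, which \<open>X_lower\<close> bounds.\<close>

lemma workload_le:
  assumes t: "t \<in> {0..T}"
  shows "(\<Sum>i\<in>I. x i t / m i) \<le> (inv_rates + rate_ratio * idle_const) * N * (1 + t)"
proof -
  let ?h = "\<lambda>s. \<Sum>i\<in>I. 1 / m i * h i s"
  have h_le: "?h s \<le> rate_ratio * idle_const * N" if s: "s \<in> {0..T}" for s
  proof -
    have "1 / m i * h i s = y i s - x i s - \<theta> i / m i * y i s
        + (if i = i0 then (\<Sum>j\<in>J. (\<nu> j - m i0) * z j s) / m i0 else 0)" if "i \<in> I" for i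
      using m_pos[OF that] by (auto simp: drift_def field_simps)
    then have "?h s = (\<Sum>i\<in>I. y i s) - X s - (\<Sum>i\<in>I. \<theta> i / m i * y i s)
        + (\<Sum>j\<in>J. (\<nu> j - m i0) * z j s) / m i0"
      using fin i0 by (simp add: sum.distrib sum_subtractf X_def)
    also have "(\<Sum>i\<in>I. y i s) - X s = (\<Sum>j\<in>J. z j s)"
      using sum_y[OF s] sum_z[OF s] by (simp add: X_def max_def)
    also have "(\<Sum>j\<in>J. (\<nu> j - m i0) * z j s) / m i0 = (\<Sum>j\<in>J. \<nu> j * z j s) / m i0 - (\<Sum>j\<in>J. z j s)"
      using m_pos[OF i0] by (simp add: left_diff_distrib sum_subtractf diff_divide_distrib flip: sum_distrib_left)
    finally have "?h s = (\<Sum>j\<in>J. \<nu> j * z j s) / m i0 - (\<Sum>i\<in>I. \<theta> i / m i * y i s)" by simp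
    moreover have "0 \<le> (\<Sum>i\<in>I. \<theta> i / m i * y i s)"
      using theta_nonneg m_pos y_nonneg s by (intro sum_nonneg mult_nonneg_nonneg) (auto simp: less_imp_le)
    moreover have "(\<Sum>j\<in>J. \<nu> j * z j s) \<le> (\<Sum>j\<in>J. rate_ratio * m i0 * z j s)"
      using rate_ratio(2) z_nonneg s by (intro sum_mono mult_right_mono) auto
    moreover have "\<dots> = rate_ratio * (\<Sum>j\<in>J. z j s) * m i0"
      by (simp add: sum_distrib_left sum_distrib_right algebra_simps)
    moreover have "rate_ratio * (\<Sum>j\<in>J. z j s) \<le> rate_ratio * (idle_const * N)"
      using sum_z_le[OF s] rate_ratio(1) by (intro mult_left_mono)
    ultimately show ?thesis using m_pos[OF i0]
      by (smt (verit) mult.assoc pos_divide_le_eq)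
  qed
  have int: "?h integrable_on {0..t}"
    using integrable_on_subinterval[OF weighted_sum_eq(2)[OF t, of "\<lambda>i. 1 / m i"], of 0 t] t by auto
  have "integral {0..t} ?h \<le> integral {0..t} (\<lambda>_. rate_ratio * idle_const * N)"
    using int h_le t by (intro integral_le) auto
  also have "\<dots> = rate_ratio * idle_const * N * t" using t by simp
  finally have int_le: "integral {0..t} ?h \<le> rate_ratio * idle_const * N * t" .
  have "(\<Sum>i\<in>I. 1 / m i * w i t) \<le> (\<Sum>i\<in>I. 1 / m i * N)"
    using m_pos w_le[OF _ t] by (intro sum_mono mult_left_mono) (auto simp: less_imp_le abs_le_iff)
  also have "\<dots> = inv_rates * N" by (simp add: inv_rates_def sum_distrib_right)
  finally have "(\<Sum>i\<in>I. x i t / m i) \<le> inv_rates * N + rate_ratio * idle_const * N * t"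
    using int_le weighted_sum_eq(1)[OF t, of "\<lambda>i. 1 / m i"] by simp
  moreover have "0 \<le> rate_ratio * idle_const * N" "0 \<le> inv_rates * N * t"
    using rate_ratio(1) idle_const_nonneg inv_rates_nonneg N_nonneg t by auto
  ultimately show ?thesis by (simp add: algebra_simps)
qed

lemma X_upper:
  assumes t: "t \<in> {0..T}"
  shows "X t \<le> a * ((inv_rates + rate_ratio * idle_const) + (idle_const + 2) * inv_rates) * N * (1 + t)"
proof -
  have t0: "0 \<le> t" using t by simp
  \<comment> \<open>Classes with \<open>m i = a\<close> have coefficient 0; the others are bounded
    below by \<open>slow_x_lower\<close> with \<open>M = idle_const * N\<close>, where
    \<open>slack\<close> is rounded up to 1.\<close>
  have "(\<Sum>i\<in>I. - ((idle_const + 2) * N * (1 / m i))) \<le> (\<Sum>i\<in>I. (1 / m i - 1 / a) * x i t)"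
  proof (rule sum_mono)
    fix i assume i: "i \<in> I"
    have c: "0 \<le> (idle_const + 2) * N" using idle_const_nonneg N_nonneg by simp
    show "- ((idle_const + 2) * N * (1 / m i)) \<le> (1 / m i - 1 / a) * x i t"
    proof (cases "m i < a")
      case True
      have M: "0 \<le> idle_const * N" using idle_const_nonneg N_nonneg by simp
      have "slack * (idle_const * N) \<le> 1 * (idle_const * N)"
        using slack M by (intro mult_right_mono) auto
      then have "- ((idle_const + 2) * N) \<le> x i t"
        using slow_x_lower[OF X_lower M i True t] M by (auto simp: algebra_simps split: if_splits)
      moreover have coef: "0 \<le> 1 / m i - 1 / a" "1 / m i - 1 / a \<le> 1 / m i"
        using True m_pos[OF i] a_pos by (auto simp: frac_le)
      ultimately have "(1 / m i - 1 / a) * - ((idle_const + 2) * N) \<le> (1 / m i - 1 / a) * x i t"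
        by (intro mult_left_mono)
      moreover have "(1 / m i - 1 / a) * ((idle_const + 2) * N) \<le> 1 / m i * ((idle_const + 2) * N)"
        using coef c by (intro mult_right_mono)
      ultimately show ?thesis by (simp add: algebra_simps)
    next
      case False
      then show ?thesis using m_le[OF i] m_pos[OF i] c by (simp add: order_antisym)
    qed
  qed
  also have "\<dots> = (\<Sum>i\<in>I. x i t / m i) - X t / a"
    by (simp add: X_def sum_divide_distrib left_diff_distrib flip: sum_subtractf)
  finally have "X t / a \<le> (\<Sum>i\<in>I. x i t / m i) + (idle_const + 2) * N * inv_rates"
    by (simp add: inv_rates_def sum_negf sum_distrib_left)
  also have "\<dots> \<le> (inv_rates + rate_ratio * idle_const) * N * (1 + t) + (idle_const + 2) * N * inv_rates * (1 + t)"
    using workload_le[OF t] idle_const_nonneg N_nonneg inv_rates_nonneg t0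
      mult_left_mono[of 1 "1 + t" "(idle_const + 2) * N * inv_rates"]
    by (intro add_mono) auto
  also have "\<dots> = ((inv_rates + rate_ratio * idle_const) + (idle_const + 2) * inv_rates) * N * (1 + t)"
    by (simp add: algebra_simps)
  finally show ?thesis using a_pos by (simp add: field_simps)
qed

section \<open>From the total to the single classes\<close>

text \<open>The factor is \<open>1 + T\<close> and not \<open>1 + t\<close>, since the barrier
  arguments need one constant for the whole interval.\<close>

lemma abs_X_le:
  assumes t: "t \<in> {0..T}"
  shows "\<bar>X t\<bar> \<le> total_const * N * (1 + T)"
proof -
  have NT: "0 \<le> N * (1 + t)" "N * (1 + t) \<le> N * (1 + T)" "N \<le> N * (1 + t)"
    using N_nonneg t mult_left_mono[of "1 + t" "1 + T" N] mult_left_mono[of 1 "1 + t" N] by auto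
  have tc: "0 \<le> total_const" using total_const_ge idle_const_nonneg by linarith
  have le: "total_const * (N * (1 + t)) \<le> total_const * (N * (1 + T))"
    by (rule mult_left_mono[OF NT(2) tc])
  have "idle_const * N \<le> total_const * (N * (1 + t))"
    by (rule mult_mono[OF total_const_ge(1) NT(3) tc N_nonneg])
  moreover have "a * ((inv_rates + rate_ratio * idle_const) + (idle_const + 2) * inv_rates) * (N * (1 + t))
      \<le> total_const * (N * (1 + t))"
    using NT total_const_ge(2) by (intro mult_right_mono)
  ultimately show ?thesis using X_lower[OF t] X_upper[OF t] le by (simp add: mult.assoc)
qed

text \<open>Apart from the restoring term, the drift contains only \<open>y\<close> and
  \<open>z\<close>, whose sums are the positive and negative parts of \<open>X\<close>.\<close>

lemma drift_perturbation:
  assumes i: "i \<in> I" and t: "t \<in> {0..T}"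
  shows "\<bar>h i t + m i * x i t\<bar> \<le> (m i + \<theta> i + m i0 * (rate_ratio + 1)) * (total_const * N * (1 + T))"
proof -
  let ?C = "total_const * N * (1 + T)"
  have C: "0 \<le> ?C" using abs_X_le[OF t] by linarith
  have "\<bar>(m i - \<theta> i) * y i t\<bar> = \<bar>m i - \<theta> i\<bar> * y i t" using y_nonneg[OF i t] by (simp add: abs_mult)
  also have "\<dots> \<le> (m i + \<theta> i) * ?C"
    using y_le[OF i t] abs_X_le[OF t] y_nonneg[OF i t] m_pos[OF i] theta_nonneg[OF i]
    by (intro mult_mono) auto
  finally have y: "\<bar>(m i - \<theta> i) * y i t\<bar> \<le> (m i + \<theta> i) * ?C" .
  have "\<bar>\<Sum>j\<in>J. (\<nu> j - m i0) * z j t\<bar> \<le> (\<Sum>j\<in>J. (m i0 * (rate_ratio + 1)) * z j t)"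
  proof (rule order_trans[OF sum_abs sum_mono])
    fix j assume j: "j \<in> J"
    have "\<bar>\<nu> j - m i0\<bar> \<le> m i0 * (rate_ratio + 1)"
      using rate_ratio(2)[OF j] nu_pos[OF j] m_pos[OF i0] rate_ratio(1)
      by (simp add: abs_le_iff algebra_simps)
    then show "\<bar>(\<nu> j - m i0) * z j t\<bar> \<le> (m i0 * (rate_ratio + 1)) * z j t"
      using z_nonneg[OF j t] by (simp add: abs_mult mult_right_mono)
  qed
  also have "\<dots> = (m i0 * (rate_ratio + 1)) * (\<Sum>j\<in>J. z j t)" by (simp add: sum_distrib_left)
  also have "\<dots> \<le> (m i0 * (rate_ratio + 1)) * ?C"
    using sum_z[OF t] abs_X_le[OF t] C m_pos[OF i0] rate_ratio(1) by (intro mult_left_mono) (auto simp: X_def)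
  finally have z: "\<bar>\<Sum>j\<in>J. (\<nu> j - m i0) * z j t\<bar> \<le> (m i0 * (rate_ratio + 1)) * ?C" .
  have z0: "0 \<le> (m i0 * (rate_ratio + 1)) * ?C" using z by linarith
  have "h i t + m i * x i t = (m i - \<theta> i) * y i t + (if i = i0 then \<Sum>j\<in>J. (\<nu> j - m i0) * z j t else 0)"
    by (simp add: drift_def)
  then show ?thesis using y z z0 unfolding distrib_right[of "m i + \<theta> i"] by (smt (verit))
qed

text \<open>Beyond \<open>G / m i\<close> in absolute value the restoring term
  \<open>- m i * x i\<close> dominates the perturbation, so both barriers apply and no further power
  of \<open>1 + T\<close> is lost.\<close>

lemma abs_x_le:
  assumes i: "i \<in> I" and t: "t \<in> {0..T}"
  shows "\<bar>x i t\<bar> \<le> ((m i + \<theta> i + m i0 * (rate_ratio + 1)) * total_const / m i + 2) * N * (1 + T)"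
proof -
  define G where "G = (m i + \<theta> i + m i0 * (rate_ratio + 1)) * (total_const * N * (1 + T))"
  have G: "\<bar>h i s + m i * x i s\<bar> \<le> G" if "s \<in> {0..T}" for s
    using drift_perturbation[OF i that] by (simp add: G_def)
  have G0: "0 \<le> G / m i" using G[OF t] m_pos[OF i] by simp
  have "0 \<le> h i s" if "s \<in> {0..T}" "x i s < - (G / m i)" for s
    using G[OF that(1)] that(2) m_pos[OF i] by (simp add: field_simps)
  from barrier_lower[OF drift_int[OF i] x_eq[OF i] w_le[OF i] this G0 t]
  have lower: "- (G / m i + 2 * N) \<le> x i t" by simp
  have "h i s \<le> 0" if "s \<in> {0..T}" "G / m i < x i s" for s
    using G[OF that(1)] that(2) m_pos[OF i] by (simp add: field_simps)
  from barrier_upper[OF drift_int[OF i] x_eq[OF i] w_le[OF i] this G0 t]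
  have upper: "x i t \<le> G / m i + 2 * N" by simp
  have "2 * N \<le> 2 * N * (1 + T)" using N_nonneg T by (simp add: algebra_simps)
  moreover have "G / m i = (m i + \<theta> i + m i0 * (rate_ratio + 1)) * total_const / m i * N * (1 + T)"
    by (simp add: G_def)
  ultimately have "G / m i + 2 * N
      \<le> ((m i + \<theta> i + m i0 * (rate_ratio + 1)) * total_const / m i + 2) * N * (1 + T)"
    by (simp only: distrib_right[of _ 2 N] distrib_right[of _ "2 * N"])
  then show ?thesis using lower upper by linarith
qed

lemma growth_bound: "(\<Sum>i\<in>I. \<bar>x i T\<bar>) \<le> growth_const * N * (1 + T)"
proof -
  have "(\<Sum>i\<in>I. \<bar>x i T\<bar>)
      \<le> (\<Sum>i\<in>I. ((m i + \<theta> i + m i0 * (rate_ratio + 1)) * total_const / m i + 2) * N * (1 + T))"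
    using abs_x_le T by (intro sum_mono) auto
  then show ?thesis by (simp add: growth_const_def sum_distrib_right)
qed

end

section \<open>The growth estimate\<close>

theorem theorem3:
  fixes nI nJ :: nat and E :: "(nat \<times> nat) set"
    and \<mu> :: "nat \<Rightarrow> nat \<Rightarrow> real" and \<theta> :: "nat \<Rightarrow> real"
  assumes E_sub: "E \<subseteq> Iset nI \<times> Jset nI nJ"
    and mu_pos: "\<And>i j. (i, j) \<in> E \<Longrightarrow> \<mu> i j > 0"
    and mu_zero: "\<And>i j. (i, j) \<notin> E \<Longrightarrow> \<mu> i j = 0"
    and theta_nonneg: "\<And>i. i \<in> Iset nI \<Longrightarrow> \<theta> i \<ge> 0"
    and tree: "tree_diam3 nI nJ E"
    and nonidl: "nonidling nI nJ E \<mu> \<theta>"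
  shows "\<exists>m4::real. \<forall>\<psi> y z w.
           system_on nI nJ E \<mu> \<theta> {0..} \<psi> y z w \<longrightarrow>
           (\<forall>t\<ge>0. l1norm (Iset nI) (\<lambda>i. xproc nI nJ \<mu> \<theta> \<psi> y w i t)
                   \<le> m4 * (1 + t) powr m4 * (1 + supnorm (Iset nI) w t))"
proof -
  obtain i0 j0 where i0: "i0 \<in> Iset nI" and j0: "j0 \<in> Jset nI nJ"
    and star_I: "\<And>i. i \<in> Iset nI \<Longrightarrow> (i, j0) \<in> E" and star_J: "\<And>j. j \<in> Jset nI nJ \<Longrightarrow> (i0, j) \<in> E"
    and only: "\<And>i j. (i, j) \<in> E \<Longrightarrow> i = i0 \<or> j = j0"
    using tree_diam3_double_star[OF E_sub tree] by blast
  have fin: "finite (Iset nI)" "finite (Jset nI nJ)" by (auto simp: Iset_def Jset_def)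
  define a where "a = Max ((\<lambda>i. \<mu> i j0) ` Iset nI)"
  interpret double_star "Iset nI" "Jset nI nJ" i0 "\<lambda>i. \<mu> i j0" \<theta> "\<lambda>j. \<mu> i0 j" a
  proof
    show le: "\<mu> i j0 \<le> a" if "i \<in> Iset nI" for i
      unfolding a_def using that fin by (intro Max_ge) auto
    fix i assume i: "i \<in> Iset nI" "\<mu> i j0 < a"
    \<comment> \<open>A class attaining the maximum is the faster class that the nonidling argument
      compares with \<open>i\<close>.\<close>
    have "a \<in> (\<lambda>i. \<mu> i j0) ` Iset nI" unfolding a_def using fin i0 by (intro Max_in) auto
    then obtain l where "l \<in> Iset nI" "a = \<mu> l j0" by blast
    then show "\<theta> i \<le> \<mu> i j0"
      using nonidling_abandonment_bound[OF mu_pos[OF star_I] nonidl j0 star_I, of l i] i by simp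
  qed (use fin i0 star_I star_J mu_pos theta_nonneg in auto)
  \<comment> \<open>The same number is factor and exponent; being at least 1, it turns the linear
    bound into the required power.\<close>
  define m4 where "m4 = max 1 growth_const"
  have "l1norm (Iset nI) (\<lambda>i. xproc nI nJ \<mu> \<theta> \<psi> y w i t)
      \<le> m4 * (1 + t) powr m4 * (1 + supnorm (Iset nI) w t)"
    if sys: "system_on nI nJ E \<mu> \<theta> {0..} \<psi> y z w" and t: "0 \<le> t" for \<psi> y z w t
  proof -
    define N where "N = supnorm (Iset nI) w t"
    define x where "x = xproc nI nJ \<mu> \<theta> \<psi> y w"
    note sys = sys[unfolded system_on_def]
    have w_N: "\<bar>w i s\<bar> \<le> N" if "i \<in> Iset nI" "s \<in> {0..t}" for i s
    proof -
      have "\<exists>B. \<forall>s\<in>{0..t}. \<bar>w i s\<bar> \<le> B" if "i \<in> Iset nI" for i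
        using sys that t by (auto simp: meas_locbdd_def)
      then obtain B where B: "\<And>i s. i \<in> Iset nI \<Longrightarrow> s \<in> {0..t} \<Longrightarrow> \<bar>w i s\<bar> \<le> B i" by metis
      have "bdd_above ((\<lambda>s. l1norm (Iset nI) (\<lambda>i. w i s)) ` {0..t})"
        unfolding l1norm_def
        by (rule bdd_aboveI2[of _ _ "\<Sum>i\<in>Iset nI. B i"]) (intro sum_mono B)
      then have "l1norm (Iset nI) (\<lambda>i. w i s) \<le> N"
        unfolding N_def supnorm_def using that by (intro cSUP_upper)
      moreover have "\<bar>w i s\<bar> \<le> l1norm (Iset nI) (\<lambda>i. w i s)"
        unfolding l1norm_def using that fin by (intro member_le_sum) auto
      ultimately show ?thesis by linarith
    qed
    have int: "f integrable_on {0..s}" "Jint f s = integral {0..s} f" if "meas_locbdd {0..} f" for f s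
      using meas_locbdd_integral[OF that, of s] by auto
    have x_sum: "x i s = (\<Sum>j\<in>Jset nI nJ. \<psi> i j s) + y i s"
      if "i \<in> Iset nI" "s \<in> {0..t}" for i s
    proof -
      have "(\<Sum>j\<in>Jset nI nJ. \<psi> i j s + \<mu> i j * Jint (\<psi> i j) s) = w i s - y i s - \<theta> i * Jint (y i) s"
        using sys that by auto
      then show ?thesis by (simp add: x_def xproc_def sum.distrib)
    qed
    have zero: "\<psi> i j s = 0" if "i \<in> Iset nI" "j \<in> Jset nI nJ" "i \<noteq> i0" "j \<noteq> j0" "s \<in> {0..t}" for i j s
    proof -
      have "(i, j) \<notin> E" using only that by blast
      then show ?thesis using sys that by simp
    qed
    have S2: "(\<Sum>i\<in>Iset nI. \<psi> i j s) = - z j s" if "j \<in> Jset nI nJ" "s \<in> {0..t}" for j s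
      using sys that by auto
    \<comment> \<open>\<open>i0\<close> is the only class adjacent to such a pool, so (S2) has a
      single term.\<close>
    have centre: "\<psi> i0 j s = - z j s" if "j \<in> Jset nI nJ" "j \<noteq> j0" "s \<in> {0..t}" for j s
    proof -
      have "(\<Sum>i\<in>Iset nI. \<psi> i j s) = (\<Sum>i\<in>Iset nI. if i = i0 then \<psi> i0 j s else 0)"
        using zero that by (intro sum.cong) auto
      then show ?thesis using S2[of j s] that fin i0 by simp
    qed
    define g where "g i s = - (\<Sum>j\<in>Jset nI nJ. \<mu> i j * \<psi> i j s) - \<theta> i * y i s" for i s
    \<comment> \<open>For \<open>i0\<close>, \<open>centre\<close> expresses the flow to the other
      pools by idleness; every other class has \<open>j0\<close> as its only pool.\<close>
    have drift_eq: "drift x y z i s = g i s" if i: "i \<in> Iset nI" and s: "s \<in> {0..t}" for i s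
    proof (cases "i = i0")
      case True
      have "(\<Sum>j\<in>Jset nI nJ. (\<mu> i0 j - \<mu> i0 j0) * z j s)
          = (\<Sum>j\<in>Jset nI nJ. \<mu> i0 j0 * \<psi> i0 j s - \<mu> i0 j * \<psi> i0 j s)"
      proof (rule sum.cong)
        fix j assume "j \<in> Jset nI nJ"
        then show "(\<mu> i0 j - \<mu> i0 j0) * z j s = \<mu> i0 j0 * \<psi> i0 j s - \<mu> i0 j * \<psi> i0 j s"
          using centre[of j s] s by (cases "j = j0") (auto simp: algebra_simps)
      qed simp
      then show ?thesis using True x_sum[OF i s]
        by (simp add: drift_def g_def sum_subtractf sum_negf sum_distrib_left algebra_simps)
    next
      case False
      then have "(\<Sum>j\<in>Jset nI nJ. c j * \<psi> i j s) = (\<Sum>j\<in>Jset nI nJ. if j = j0 then c j0 * \<psi> i j0 s else 0)"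
        for c using zero i s by (intro sum.cong) auto
      then have "(\<Sum>j\<in>Jset nI nJ. c j * \<psi> i j s) = c j0 * \<psi> i j0 s" for c
        using fin j0 by simp
      from this[of "\<mu> i"] this[of "\<lambda>_. 1"] show ?thesis
        using False x_sum[OF i s] by (simp add: drift_def g_def algebra_simps)
    qed
    have g_int: "g i integrable_on {0..s}" and x_g: "x i s = w i s + integral {0..s} (g i)"
      if i: "i \<in> Iset nI" for i s
    proof -
      have 1: "(\<lambda>s. \<Sum>j\<in>Jset nI nJ. \<mu> i j * \<psi> i j s) integrable_on {0..s}"
        using sys i fin by (intro integrable_sum integrable_on_mult_right int) auto
      have 2: "(\<lambda>s. \<theta> i * y i s) integrable_on {0..s}"
        using sys i by (intro integrable_on_mult_right int) auto
      show "g i integrable_on {0..s}"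
        unfolding g_def by (intro integrable_diff integrable_neg 1 2)
      have "integral {0..s} (g i)
          = - integral {0..s} (\<lambda>s. \<Sum>j\<in>Jset nI nJ. \<mu> i j * \<psi> i j s) - integral {0..s} (\<lambda>s. \<theta> i * y i s)"
        unfolding g_def using integral_diff[OF integrable_neg[OF 1] 2] by simp
      also have "integral {0..s} (\<lambda>s. \<Sum>j\<in>Jset nI nJ. \<mu> i j * \<psi> i j s)
          = (\<Sum>j\<in>Jset nI nJ. integral {0..s} (\<lambda>s. \<mu> i j * \<psi> i j s))"
        using sys i fin by (intro integral_sum integrable_on_mult_right int) auto
      also have "\<dots> = (\<Sum>j\<in>Jset nI nJ. \<mu> i j * Jint (\<psi> i j) s)"
        using sys i int by (intro sum.cong) auto
      also have "integral {0..s} (\<lambda>s. \<theta> i * y i s) = \<theta> i * Jint (y i) s"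
        using sys i int by auto
      finally show "x i s = w i s + integral {0..s} (g i)" by (simp add: x_def xproc_def)
    qed
    \<comment> \<open>Summing \<open>\<psi>\<close> by classes and by pools gives the balance;
      together with (S4), total queue and total idleness become the positive and negative parts of
      the sum of \<open>x\<close>.\<close>
    have bal: "(\<Sum>i\<in>Iset nI. x i s) = (\<Sum>i\<in>Iset nI. y i s) - (\<Sum>j\<in>Jset nI nJ. z j s)"
      if "s \<in> {0..t}" for s
    proof -
      have "(\<Sum>i\<in>Iset nI. x i s) = (\<Sum>i\<in>Iset nI. \<Sum>j\<in>Jset nI nJ. \<psi> i j s) + (\<Sum>i\<in>Iset nI. y i s)"
        using x_sum that by (simp add: sum.distrib)
      also have "(\<Sum>i\<in>Iset nI. \<Sum>j\<in>Jset nI nJ. \<psi> i j s) = (\<Sum>j\<in>Jset nI nJ. - z j s)"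
        using S2 that by (subst sum.swap) simp
      finally show ?thesis by (simp add: sum_negf)
    qed
    have min0: "min (\<Sum>i\<in>Iset nI. y i s) (\<Sum>j\<in>Jset nI nJ. z j s) = 0" if "s \<in> {0..t}" for s
      using sys that by auto
    have compl: "(\<Sum>i\<in>Iset nI. y i s) = max (\<Sum>i\<in>Iset nI. x i s) 0"
        "(\<Sum>j\<in>Jset nI nJ. z j s) = max (- (\<Sum>i\<in>Iset nI. x i s)) 0" if "s \<in> {0..t}" for s
      using bal[OF that] min0[OF that] by (auto simp: min_def max_def split: if_splits)
    interpret double_star_trajectory "Iset nI" "Jset nI nJ" i0 "\<lambda>i. \<mu> i j0" \<theta> "\<lambda>j. \<mu> i0 j" a t N x w y z
    proof
      fix i assume i: "i \<in> Iset nI"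
      show "drift x y z i integrable_on {0..t}"
        using integrable_eq[OF g_int[OF i]] drift_eq[OF i] by simp
      fix s assume s: "s \<in> {0..t}"
      have "integral {0..s} (drift x y z i) = integral {0..s} (g i)"
        using drift_eq[OF i] s by (intro integral_cong) auto
      then show "x i s = w i s + integral {0..s} (drift x y z i)" using x_g[OF i] by simp
    qed (use t w_N compl sys in auto)
    have "1 + t \<le> (1 + t) powr m4"
      using powr_mono[of 1 m4 "1 + t"] t by (simp add: m4_def)
    then have "growth_const * (1 + t) * N \<le> m4 * (1 + t) powr m4 * (1 + N)"
      using growth_const_nonneg N_nonneg t by (intro mult_mono) (auto simp: m4_def)
    moreover have "l1norm (Iset nI) (\<lambda>i. x i t) \<le> growth_const * N * (1 + t)"
      using growth_bound by (simp add: l1norm_def)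
    ultimately show ?thesis by (simp add: x_def N_def mult_ac)
  qed
  then show ?thesis by blast
qed

end
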